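(* Let $I=[a,b]$, let $f:I\times\mathbb{R}^2\times AC(I)\to\mathbb{R}$, $B:\mathbb{R}\times AC(I)\to\mathbb{R}$ and let $\tau:I\to I$ be measurable. Consider the problem $$(P)\qquad x'(t)=f(t,x(t),x(\tau(t)),x)\ \text{ for a.a. } t\in I,\qquad B(x(a),x)=0,$$ and assume that: (1) $\tau$ is a delayed argument, i.e. $\tau(t)\le t$ for a.a. $t\in I$. (2) For a.a. $t\in I$, all $x\in\mathbb{R}$ and all $\gamma\in AC(I)$ the function $f(t,x,\cdot,\gamma)$ is nondecreasing. (3) There exists a nondecreasing linear functional $\phi:AC(I)\to\mathbb{R}$ such that $B(x(a),x)=x(a)-\phi(x)$ for all $x\in AC(I)$. (4) For a.a. $t\in I$, all $x,y\in\mathbb{R}$ and all $\gamma\in AC(I)$ we have $$|f(t,x,y,\gamma)|\le p(t)\,h(|x|,|y|),$$ where $p\in L^1(I,\mathbb{R}^+)$, $h:[0,\infty)\times[0,\infty)\to[0,\infty)$ is nondecreasing in both of its arguments and $$\int_0^\infty\frac{du}{h(u,u)}=\infty.$$ Suppose that there exist nonnegative numbers $m,n_\alpha,n_\beta$, with $n_i\le m$ for $i=\alpha,\beta$, such that $$m-\phi(w)\ge n_i\,(1-\phi(1)),\qquad i=\alpha,\beta,$$ where $w$ is the unique solution of the initial value problem $$w'(t)=p(t)\,h(w(t),w(t)),\ t\in I,\qquad w(a)=m.$$ Then the functions $$\alpha(t)=-w(t)+n_\alpha,\qquad \beta(t)=w(t)-n_\beta\qquad(t\in I)$$ are, respectively,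 a lower and an upper solution for problem $(P)$, and they satisfy $\alpha\le\beta$ on $I$. In particular, the existence of such numbers $m,n_\alpha,n_\beta$ is a sufficient condition for the existence of a lower and an upper solution for problem $(P)$.
   Context: $I=[a,b]$ is a compact real interval and $AC(I)$ is the set of absolutely continuous real functions on $I$, ordered pointwise. "a.a." refers to Lebesgue measure. The functional $\phi$ being nondecreasing means $\phi(x)\le\phi(y)$ whenever $x,y\in AC(I)$ and $x\le y$ on $I$; $\phi(1)$ is the value of $\phi$ at the constant function $1$. Solutions of differential equations are absolutely continuous functions on $I$ satisfying the equation for almost all $t\in I$. A function $\alpha\in AC(I)$ is a lower solution for $(P)$ if the composition $t\in I\mapsto f(t,\alpha(t),\alpha(\tau(t)),\alpha)$ is measurable, $\alpha'(t)\le f(t,\alpha(t),\alpha(\tau(t)),\alpha)$ for a.a. $t\in I$, and $B(\alpha(a),\alpha)\le 0$. An upper solution $\beta\in AC(I)$ is defined analogously with the inequalities reversed: $t\mapsto f(t,\beta(t),\beta(\tau(t)),\beta)$ is measurable, $\beta'(t)\ge f(t,\beta(t),\beta(\tau(t)),\beta)$ for a.a. $t\in I$, and $B(\beta(a),\beta)\ge 0$.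
   Formalization: The formal theorem additionally assumes that t ↦ f(t,x(t),x(τ(t)),x) is measurable for every x in AC(I); without it the claim fails, e.g. f the indicator of a nonmeasurable set in t, p=h=1, φ=0, m=n_α=n_β=0. *)

theory Defs
  imports "HOL-Analysis.Analysis"
begin

(* The elements of AC a b are functions on [a,b] only, encoded as extensional total functions
   (value undefined outside [a,b]); hence they are built with restricted abstractions, and
   equality in HOL is equality on [a,b].  The library constant absolutely_continuous concerns
   measures, not functions. *)
definition AC :: "real \<Rightarrow> real \<Rightarrow> (real \<Rightarrow> real) set" where
  "AC a b = {x \<in> extensional {a..b}.
     \<forall>\<epsilon>>0. \<exists>\<delta>>0. \<forall>D :: (real \<times> real) set.
       finite D \<and> (\<forall>(u, v)\<in>D. a \<le> u \<and> u \<le> v \<and> v \<le> b) \<and>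
       disjoint_family_on (\<lambda>(u, v). {u<..<v}) D \<and>
       (\<Sum>(u, v)\<in>D. v - u) < \<delta>
       \<longrightarrow> (\<Sum>(u, v)\<in>D. \<bar>x v - x u\<bar>) < \<epsilon>}"

definition nondecreasing_linear_functional ::
    "real \<Rightarrow> real \<Rightarrow> ((real \<Rightarrow> real) \<Rightarrow> real) \<Rightarrow> bool" where
  "nondecreasing_linear_functional a b \<phi> \<longleftrightarrow>
     (\<forall>x\<in>AC a b. \<forall>y\<in>AC a b. \<phi> (\<lambda>t\<in>{a..b}. x t + y t) = \<phi> x + \<phi> y) \<and>
     (\<forall>c. \<forall>x\<in>AC a b. \<phi> (\<lambda>t\<in>{a..b}. c * x t) = c * \<phi> x) \<and>
     (\<forall>x\<in>AC a b. \<forall>y\<in>AC a b. (\<forall>t\<in>{a..b}. x t \<le> y t) \<longrightarrow> \<phi> x \<le> \<phi> y)"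

(* In the next definitions, an (in)equality involving x'(t) includes the existence of x'(t). *)

definition lower_solution ::
    "real \<Rightarrow> real \<Rightarrow> (real \<Rightarrow> real \<Rightarrow> real \<Rightarrow> (real \<Rightarrow> real) \<Rightarrow> real) \<Rightarrow> (real \<Rightarrow> real)
     \<Rightarrow> (real \<Rightarrow> (real \<Rightarrow> real) \<Rightarrow> real) \<Rightarrow> (real \<Rightarrow> real) \<Rightarrow> bool" where
  "lower_solution a b f \<tau> B \<alpha> \<longleftrightarrow>
     \<alpha> \<in> AC a b \<and>
     (\<lambda>t. f t (\<alpha> t) (\<alpha> (\<tau> t)) \<alpha>) \<in> borel_measurable (lebesgue_on {a..b}) \<and>
     (AE t in lebesgue_on {a..b}. \<exists>d. (\<alpha> has_real_derivative d) (at t within {a..b}) \<and>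
        d \<le> f t (\<alpha> t) (\<alpha> (\<tau> t)) \<alpha>) \<and>
     B (\<alpha> a) \<alpha> \<le> 0"

definition upper_solution ::
    "real \<Rightarrow> real \<Rightarrow> (real \<Rightarrow> real \<Rightarrow> real \<Rightarrow> (real \<Rightarrow> real) \<Rightarrow> real) \<Rightarrow> (real \<Rightarrow> real)
     \<Rightarrow> (real \<Rightarrow> (real \<Rightarrow> real) \<Rightarrow> real) \<Rightarrow> (real \<Rightarrow> real) \<Rightarrow> bool" where
  "upper_solution a b f \<tau> B \<beta> \<longleftrightarrow>
     \<beta> \<in> AC a b \<and>
     (\<lambda>t. f t (\<beta> t) (\<beta> (\<tau> t)) \<beta>) \<in> borel_measurable (lebesgue_on {a..b}) \<and>
     (AE t in lebesgue_on {a..b}. \<exists>d. (\<beta> has_real_derivative d) (at t within {a..b}) \<and>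
        d \<ge> f t (\<beta> t) (\<beta> (\<tau> t)) \<beta>) \<and>
     B (\<beta> a) \<beta> \<ge> 0"

(* Solutions of w' = p h(w,w), w(a) = m.  They must be nonnegative because h is only defined
   on [0,\<infinity>)^2; the values of the total function h elsewhere are irrelevant. *)
definition ivp_solution ::
    "real \<Rightarrow> real \<Rightarrow> (real \<Rightarrow> real) \<Rightarrow> (real \<Rightarrow> real \<Rightarrow> real) \<Rightarrow> real \<Rightarrow> (real \<Rightarrow> real) \<Rightarrow> bool" where
  "ivp_solution a b p h m w \<longleftrightarrow>
     w \<in> AC a b \<and> (\<forall>t\<in>{a..b}. 0 \<le> w t) \<and>
     (AE t in lebesgue_on {a..b}. (w has_real_derivative p t * h (w t) (w t)) (at t within {a..b})) \<and>
     w a = m"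

definition admissible_numbers ::
    "real \<Rightarrow> real \<Rightarrow> (real \<Rightarrow> real) \<Rightarrow> (real \<Rightarrow> real \<Rightarrow> real) \<Rightarrow> ((real \<Rightarrow> real) \<Rightarrow> real)
     \<Rightarrow> real \<Rightarrow> real \<Rightarrow> real \<Rightarrow> (real \<Rightarrow> real) \<Rightarrow> bool" where
  "admissible_numbers a b p h \<phi> m n\<^sub>\<alpha> n\<^sub>\<beta> w \<longleftrightarrow>
     0 \<le> m \<and> 0 \<le> n\<^sub>\<alpha> \<and> 0 \<le> n\<^sub>\<beta> \<and> n\<^sub>\<alpha> \<le> m \<and> n\<^sub>\<beta> \<le> m \<and>
     ivp_solution a b p h m w \<and> (\<forall>v. ivp_solution a b p h m v \<longrightarrow> v = w) \<and>
     m - \<phi> w \<ge> n\<^sub>\<alpha> * (1 - \<phi> (\<lambda>t\<in>{a..b}. 1)) \<and>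
     m - \<phi> w \<ge> n\<^sub>\<beta> * (1 - \<phi> (\<lambda>t\<in>{a..b}. 1))"

end

theory Submission
  imports Defs
begin

text \<open>The solution \<open>w\<close> of the initial value problem has derivative \<open>p t * h (w t) (w t) \<ge> 0\<close> almost
  everywhere, and for an absolutely continuous function this forces \<open>w\<close> to be nondecreasing
  (\<open>AC_mono_on\<close>).  Hence \<open>w \<ge> m \<ge> n\<close> for each of the two numbers \<open>n\<close>, and both \<open>\<alpha> = n\<^sub>\<alpha> - w\<close> and
  \<open>\<beta> = w - n\<^sub>\<beta>\<close> are bounded in modulus by \<open>w\<close>.  As the argument \<open>\<tau>\<close> is delayed and \<open>w\<close> is
  nondecreasing, both \<open>\<bar>x t\<bar>\<close> and \<open>\<bar>x (\<tau> t)\<bar>\<close> are at most \<open>w t\<close> for \<open>x = \<alpha>\<close> and \<open>x = \<beta>\<close>, so the growth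
  condition on \<open>f\<close> and the monotonicity of \<open>h\<close> give
  \<open>\<bar>f t (x t) (x (\<tau> t)) x\<bar> \<le> p t * h (w t) (w t) = w' t\<close> (\<open>delayed_growth_bound\<close>).
  Since \<open>\<alpha>' = - w'\<close> and \<open>\<beta>' = w'\<close>, these are the two differential inequalities.  The boundary
  inequalities are the hypotheses on \<open>m - \<phi> w\<close>, rewritten by the linearity of \<open>\<phi>\<close>, and \<open>\<alpha> \<le> \<beta>\<close>
  amounts to \<open>n\<^sub>\<alpha> + n\<^sub>\<beta> \<le> 2 * w t\<close>, which follows from \<open>m \<le> w t\<close>.

  The one analytic ingredient is the monotonicity of \<open>w\<close>.  It is proved by Cousin's lemma: a gauge
  is chosen which makes the increments of \<open>w\<close> almost nonnegative on the intervals tagged at points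
  where the derivative exists and is nonnegative, and keeps the intervals tagged at the other points
  inside an open set of small measure, on which absolute continuity controls the total variation.\<close>

section \<open>Monotonicity of absolutely continuous functions\<close>

text \<open>Splitting at the point of differentiability \<open>t\<close> turns the one-point estimate of the
  derivative into one for the increment over an interval that contains \<open>t\<close>.\<close>

lemma increment_ge_of_nonneg_derivative:
  fixes w :: "real \<Rightarrow> real"
  assumes w: "(w has_real_derivative d) (at t within S)" and "0 \<le> d" "0 < \<epsilon>"
  obtains \<delta> where "0 < \<delta>"
    "\<And>u v. u \<in> S \<Longrightarrow> v \<in> S \<Longrightarrow> u \<le> t \<Longrightarrow> t \<le> v \<Longrightarrow> {u, v} \<subseteq> ball t \<delta> \<Longrightarrow>
       - \<epsilon> * (v - u) \<le> w v - w u"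
proof -
  from w obtain \<delta> where "0 < \<delta>"
    and \<delta>: "\<And>y. y \<in> S \<Longrightarrow> norm (y - t) < \<delta> \<Longrightarrow> norm (w y - w t - d * (y - t)) \<le> \<epsilon> * norm (y - t)"
    unfolding has_field_derivative_def has_derivative_within_alt using \<open>0 < \<epsilon>\<close> by blast
  show thesis
  proof (rule that[OF \<open>0 < \<delta>\<close>])
    fix u v assume "u \<in> S" "v \<in> S" "u \<le> t" "t \<le> v" "{u, v} \<subseteq> ball t \<delta>"
    then have "\<bar>w u - w t - d * (u - t)\<bar> \<le> \<epsilon> * \<bar>u - t\<bar>" "\<bar>w v - w t - d * (v - t)\<bar> \<le> \<epsilon> * \<bar>v - t\<bar>"
      using \<delta>[of u] \<delta>[of v] by (auto simp: dist_real_def abs_minus_commute)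
    moreover have "d * (u - t) \<le> 0" "0 \<le> d * (v - t)"
      using \<open>0 \<le> d\<close> \<open>u \<le> t\<close> \<open>t \<le> v\<close> by (auto simp: mult_nonneg_nonpos)
    ultimately show "- \<epsilon> * (v - u) \<le> w v - w u"
      using \<open>u \<le> t\<close> \<open>t \<le> v\<close> by (simp add: algebra_simps)
  qed
qed

text \<open>The members of a tagged division are closed intervals, whereas \<open>AC\<close> speaks of pairs of end
  points; the following lemma carries the estimate over.  Distinct members of the division have distinct
  pairs of end points, even when their interiors are empty, because a degenerate interval determines
  its tag.\<close>

lemma AC_sum_tagged_division:
  assumes w: "w \<in> AC a b" and "0 < \<epsilon>"
  shows "\<exists>\<delta>>0. \<forall>q U. q tagged_partial_division_of {a..b} \<and> U \<in> lmeasurable \<and>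
       measure lebesgue U < \<delta> \<and> (\<forall>(x, K)\<in>q. K \<subseteq> U) \<longrightarrow>
       (\<Sum>(x, K)\<in>q. \<bar>w (Sup K) - w (Inf K)\<bar>) < \<epsilon>"
proof -
  from w \<open>0 < \<epsilon>\<close> obtain \<delta> where "0 < \<delta>" and \<delta>: "\<And>D :: (real \<times> real) set.
       finite D \<Longrightarrow> (\<forall>(u, v)\<in>D. a \<le> u \<and> u \<le> v \<and> v \<le> b) \<Longrightarrow>
       disjoint_family_on (\<lambda>(u, v). {u<..<v}) D \<Longrightarrow>
       (\<Sum>(u, v)\<in>D. v - u) < \<delta> \<Longrightarrow> (\<Sum>(u, v)\<in>D. \<bar>w v - w u\<bar>) < \<epsilon>"
    unfolding AC_def by (simp add: conj_imp_eq_imp_imp) meson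
  show ?thesis
  proof (intro exI[of _ \<delta>] conjI allI impI \<open>0 < \<delta>\<close>, elim conjE)
    fix q U
    assume q: "q tagged_partial_division_of {a..b}" and U: "U \<in> lmeasurable" "measure lebesgue U < \<delta>"
      and "\<forall>(x, K)\<in>q. K \<subseteq> U"
    then have qU: "K \<subseteq> U" if "(x, K) \<in> q" for x K using that by blast
    define e :: "real \<times> real set \<Rightarrow> real \<times> real" where "e = (\<lambda>(x, K). (Inf K, Sup K))"
    have K: "x \<in> K \<and> K \<subseteq> {a..b} \<and> Inf K \<le> Sup K \<and> K = {Inf K..Sup K}" if xK: "(x, K) \<in> q" for x K
    proof -
      obtain u v where uv: "K = cbox u v" "x \<in> K" "K \<subseteq> {a..b}"
        using tagged_partial_division_ofD(2,3,4)[OF q xK] by metis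
      then show ?thesis by auto
    qed
    have int: "interior K = {Inf K<..<Sup K}" if "(x, K) \<in> q" for x K
      using K[OF that] interior_atLeastAtMost_real by metis
    have disj: "{Inf K<..<Sup K} \<inter> {Inf L<..<Sup L} = {}"
      if "(x, K) \<in> q" "(y, L) \<in> q" "(x, K) \<noteq> (y, L)" for x K y L
      using tagged_partial_division_ofD(5)[OF q that] int that by metis
    have inj: "inj_on e q"
    proof (rule inj_onI, clarify)
      fix x K y L assume xK: "(x, K) \<in> q" and yL: "(y, L) \<in> q" and "e (x, K) = e (y, L)"
      then have eq: "Inf K = Inf L" "Sup K = Sup L" by (auto simp: e_def)
      then have "K = L" using K[OF xK] K[OF yL] by metis
      show "x = y \<and> K = L"
      proof (rule ccontr)
        assume "\<not> (x = y \<and> K = L)"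
        then have "{Inf K<..<Sup K} = {}" using disj[OF xK yL] eq by auto
        then have "Inf K = Sup K" using K[OF xK] by (metis greaterThanLessThan_empty_iff order_antisym)
        then have "x = Inf K" "y = Inf K" using K[OF xK] K[OF yL] \<open>K = L\<close>
          by (metis atLeastAtMost_singleton singletonD)+
        then show False using \<open>\<not> (x = y \<and> K = L)\<close> \<open>K = L\<close> by simp
      qed
    qed
    have fin: "finite q" using q by (rule tagged_partial_division_ofD(1))
    have bnds: "\<forall>(u, v)\<in>e ` q. a \<le> u \<and> u \<le> v \<and> v \<le> b"
    proof -
      have "a \<le> Inf L \<and> Inf L \<le> Sup L \<and> Sup L \<le> b" if "(y, L) \<in> q" for y L
        using K[OF that] by (metis atLeastatMost_subset_iff)
      then show ?thesis by (auto simp: e_def)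
    qed
    have disjD: "disjoint_family_on (\<lambda>(u, v). {u<..<v}) (e ` q)"
      unfolding disjoint_family_on_def e_def using disj by fastforce
    have "(\<Sum>(u, v)\<in>e ` q. v - u) = (\<Sum>i\<in>e ` q. measure lebesgue (case i of (u, v) \<Rightarrow> {u<..<v}))"
      using bnds by (intro sum.cong) auto
    also have "\<dots> = measure lebesgue (\<Union>i\<in>e ` q. case i of (u, v) \<Rightarrow> {u<..<v})"
    proof (rule measure_finite_Union[symmetric])
      show "emeasure lebesgue (case i of (u, v) \<Rightarrow> {u<..<v}) \<noteq> \<infinity>" if "i \<in> e ` q" for i
        using bnds that by (auto split: prod.splits)
    qed (use fin disjD in auto)
    also have "\<dots> \<le> measure lebesgue U"
    proof (rule measure_mono_fmeasurable)
      have "{Inf K<..<Sup K} \<subseteq> U" if "(x, K) \<in> q" for x K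
        using int[OF that] qU[OF that] interior_subset by blast
      then show "(\<Union>i\<in>e ` q. case i of (u, v) \<Rightarrow> {u<..<v}) \<subseteq> U"
        by (auto simp: e_def)
    qed (use U fin in \<open>auto intro!: sets.finite_UN simp: e_def\<close>)
    finally have "(\<Sum>(u, v)\<in>e ` q. v - u) < \<delta>" using U by simp
    then have "(\<Sum>(u, v)\<in>e ` q. \<bar>w v - w u\<bar>) < \<epsilon>"
      using fin bnds disjD by (intro \<delta>) auto
    then show "(\<Sum>(x, K)\<in>q. \<bar>w (Sup K) - w (Inf K)\<bar>) < \<epsilon>"
      unfolding sum.reindex[OF inj] by (simp add: e_def case_prod_unfold)
  qed
qed

text \<open>By Cousin's lemma there is a tagged division of \<open>{s..t}\<close> whose intervals tagged in the
  exceptional null set lie in an open set so small that they contribute less than \<open>\<epsilon>\<close> to the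
  increment of \<open>w\<close>, while the others contribute at least \<open>- \<epsilon>\<close> times their lengths.\<close>

lemma AC_mono_on:
  assumes w: "w \<in> AC a b"
    and deriv: "AE t in lebesgue_on {a..b}. \<exists>d\<ge>0. (w has_real_derivative d) (at t within {a..b})"
  shows "mono_on {a..b} w"
proof (rule mono_onI)
  fix s t assume st: "s \<in> {a..b}" "t \<in> {a..b}" "s \<le> t"
  define E where "E = {x \<in> {a..b}. \<not> (\<exists>d\<ge>0. (w has_real_derivative d) (at x within {a..b}))}"
  have "AE x in lebesgue. x \<in> {a..b} \<longrightarrow> (\<exists>d\<ge>0. (w has_real_derivative d) (at x within {a..b}))"
    using deriv by (simp add: AE_restrict_space_iff)
  then have "AE x in lebesgue. x \<notin> E" by (rule AE_mp) (simp add: E_def)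
  then obtain N where "E \<subseteq> N" "N \<in> null_sets lebesgue"
    by (auto simp: eventually_ae_filter)
  then have E: "E \<in> null_sets lebesgue" by (rule null_sets_completion_subset)
  have approx: "- \<epsilon> * (1 + (t - s)) \<le> w t - w s" if "0 < \<epsilon>" for \<epsilon> :: real
  proof -
    obtain \<delta> where "0 < \<delta>" and \<delta>: "\<forall>q U. q tagged_partial_division_of {a..b} \<and> U \<in> lmeasurable \<and>
        measure lebesgue U < \<delta> \<and> (\<forall>(x, K)\<in>q. K \<subseteq> U) \<longrightarrow>
        (\<Sum>(x, K)\<in>q. \<bar>w (Sup K) - w (Inf K)\<bar>) < \<epsilon>"
      using AC_sum_tagged_division[OF w \<open>0 < \<epsilon>\<close>] by blast
    obtain U where U: "open U" "E \<subseteq> U" "U - E \<in> lmeasurable" "emeasure lebesgue (U - E) < ennreal \<delta>"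
      using sets_lebesgue_outer_open[of E \<delta>] E \<open>0 < \<delta>\<close> by (auto dest: null_setsD2)
    have UE: "emeasure lebesgue U = emeasure lebesgue (U - E)"
      using U(1) E by (simp add: emeasure_Diff_null_set)
    then have U': "U \<in> lmeasurable"
      using U(1,3) by (simp only: fmeasurable_def mem_Collect_eq) auto
    have Umeas: "measure lebesgue U < \<delta>"
      using U(4) U' by (simp add: UE[symmetric] emeasure_eq_measure2 ennreal_less_iff)
    have "\<exists>r>0. (x \<in> E \<longrightarrow> ball x r \<subseteq> U) \<and> (x \<in> {a..b} - E \<longrightarrow>
        (\<forall>u v. u \<in> {a..b} \<and> v \<in> {a..b} \<and> u \<le> x \<and> x \<le> v \<and> {u, v} \<subseteq> ball x r \<longrightarrow>
          - \<epsilon> * (v - u) \<le> w v - w u))" for x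
    proof (cases "x \<in> E")
      case True
      then show ?thesis using U(1,2) by (auto simp: open_contains_ball)
    next
      case False
      show ?thesis
      proof (cases "x \<in> {a..b}")
        case True
        with False obtain d where "0 \<le> d" "(w has_real_derivative d) (at x within {a..b})"
          by (auto simp: E_def)
        from increment_ge_of_nonneg_derivative[OF this(2,1) \<open>0 < \<epsilon>\<close>] show ?thesis
          using False by metis
      qed (use False in \<open>auto intro: exI[of _ 1]\<close>)
    qed
    then obtain r where r: "\<And>x. 0 < r x" "\<And>x. x \<in> E \<Longrightarrow> ball x (r x) \<subseteq> U"
      "\<And>x u v. x \<in> {a..b} - E \<Longrightarrow> u \<in> {a..b} \<Longrightarrow> v \<in> {a..b} \<Longrightarrow> u \<le> x \<Longrightarrow> x \<le> v \<Longrightarrow>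
          {u, v} \<subseteq> ball x (r x) \<Longrightarrow> - \<epsilon> * (v - u) \<le> w v - w u"
      by metis
    have "gauge (\<lambda>x. ball x (r x))" using r(1) by (auto simp: gauge_def)
    then obtain q where q: "q tagged_division_of {s..t}" and fine: "(\<lambda>x. ball x (r x)) fine q"
      using fine_division_exists_real by blast
    have fin: "finite q" using q by blast
    have K: "x \<in> K \<and> K \<subseteq> {s..t} \<and> Inf K \<le> x \<and> x \<le> Sup K \<and> Inf K \<in> K \<and> Sup K \<in> K \<and>
        K \<subseteq> ball x (r x) \<and> measure lborel K = Sup K - Inf K"
      if xK: "(x, K) \<in> q" for x K
    proof -
      obtain u v where "K = cbox u v" "x \<in> K" "K \<subseteq> {s..t}"
        using tagged_division_ofD(2,3,4)[OF q xK] by metis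
      then show ?thesis using fineD[OF fine xK] by auto
    qed
    define q1 where "q1 = {z \<in> q. fst z \<in> E}"
    have "q1 \<subseteq> q" by (auto simp: q1_def)
    have "q tagged_partial_division_of {s..t}" "{s..t} \<subseteq> {a..b}"
      using q st by (auto simp: tagged_division_of_def)
    then have "q tagged_partial_division_of {a..b}"
      unfolding tagged_partial_division_of_def by (meson subset_trans)
    then have "q1 tagged_partial_division_of {a..b}"
      using \<open>q1 \<subseteq> q\<close> by (rule tagged_partial_division_subset)
    moreover have "\<forall>(x, K)\<in>q1. K \<subseteq> U"
      using K r(2) unfolding q1_def by fastforce
    ultimately have q1: "(\<Sum>(x, K)\<in>q1. \<bar>w (Sup K) - w (Inf K)\<bar>) < \<epsilon>"
      using \<delta> U' Umeas by blast
    then have sum1: "- \<epsilon> \<le> (\<Sum>(x, K)\<in>q1. w (Sup K) - w (Inf K))"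
      using sum_abs[of "\<lambda>(x, K). w (Sup K) - w (Inf K)" q1]
      unfolding case_prod_unfold by linarith
    have good: "- \<epsilon> * (Sup K - Inf K) \<le> w (Sup K) - w (Inf K)" if "(x, K) \<in> q - q1" for x K
    proof (rule r(3)[of x])
      show "x \<in> {a..b} - E" "Inf K \<in> {a..b}" "Sup K \<in> {a..b}" "Inf K \<le> x" "x \<le> Sup K"
        "{Inf K, Sup K} \<subseteq> ball x (r x)"
        using K[of x K] that st by (auto simp: q1_def subset_iff)
    qed
    have len: "(\<Sum>(x, K)\<in>q. Sup K - Inf K) = t - s"
      using additive_tagged_division_1[OF st(3) q, of "\<lambda>x. x"] by simp
    have "(\<Sum>(x, K)\<in>q - q1. Sup K - Inf K) \<le> (\<Sum>(x, K)\<in>q. Sup K - Inf K)"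
      using fin K by (intro sum_mono2) fastforce+
    then have "- \<epsilon> * (t - s) \<le> - \<epsilon> * (\<Sum>(x, K)\<in>q - q1. Sup K - Inf K)"
      using \<open>0 < \<epsilon>\<close> len by simp
    also have "\<dots> = (\<Sum>(x, K)\<in>q - q1. - \<epsilon> * (Sup K - Inf K))"
      by (simp add: sum_distrib_left case_prod_unfold)
    also have "\<dots> \<le> (\<Sum>(x, K)\<in>q - q1. w (Sup K) - w (Inf K))"
      using good by (intro sum_mono) auto
    finally have sum2: "- \<epsilon> * (t - s) \<le> (\<Sum>(x, K)\<in>q - q1. w (Sup K) - w (Inf K))" .
    have "w t - w s = (\<Sum>(x, K)\<in>q. w (Sup K) - w (Inf K))"
      using additive_tagged_division_1[OF st(3) q, of w] by simp
    also have "\<dots> = (\<Sum>(x, K)\<in>q - q1. w (Sup K) - w (Inf K)) + (\<Sum>(x, K)\<in>q1. w (Sup K) - w (Inf K))"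
      using fin \<open>q1 \<subseteq> q\<close> by (rule sum.subset_diff[rotated])
    finally show ?thesis using sum1 sum2 by (simp add: algebra_simps)
  qed
  show "w s \<le> w t"
  proof (rule ccontr)
    assume "\<not> w s \<le> w t"
    define \<epsilon> where "\<epsilon> = (w s - w t) / (2 * (1 + (t - s)))"
    have "0 < \<epsilon>" "\<epsilon> * (1 + (t - s)) = (w s - w t) / 2"
      using \<open>\<not> w s \<le> w t\<close> st by (auto simp: \<epsilon>_def field_simps)
    then show False using approx[of \<epsilon>] \<open>\<not> w s \<le> w t\<close> by (simp add: field_simps)
  qed
qed

section \<open>Affine images of absolutely continuous functions\<close>

lemma AC_affine:
  assumes "x \<in> AC a b"
  shows "(\<lambda>t\<in>{a..b}. c * x t + d) \<in> AC a b"
  unfolding AC_def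
proof (intro CollectI conjI allI impI)
  show "(\<lambda>t\<in>{a..b}. c * x t + d) \<in> extensional {a..b}" by simp
next
  fix \<epsilon> :: real assume "0 < \<epsilon>"
  then have "0 < \<epsilon> / (\<bar>c\<bar> + 1)" by simp
  with assms obtain \<delta> where "0 < \<delta>" and \<delta>: "\<And>D :: (real \<times> real) set.
       finite D \<Longrightarrow> (\<forall>(u, v)\<in>D. a \<le> u \<and> u \<le> v \<and> v \<le> b) \<Longrightarrow>
       disjoint_family_on (\<lambda>(u, v). {u<..<v}) D \<Longrightarrow>
       (\<Sum>(u, v)\<in>D. v - u) < \<delta> \<Longrightarrow> (\<Sum>(u, v)\<in>D. \<bar>x v - x u\<bar>) < \<epsilon> / (\<bar>c\<bar> + 1)"
    unfolding AC_def by (simp add: conj_imp_eq_imp_imp) meson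
  let ?y = "\<lambda>t\<in>{a..b}. c * x t + d"
  have "(\<Sum>(u, v)\<in>D. \<bar>?y v - ?y u\<bar>) < \<epsilon>"
    if D: "finite D" "\<forall>(u, v)\<in>D. a \<le> u \<and> u \<le> v \<and> v \<le> b"
      "disjoint_family_on (\<lambda>(u, v). {u<..<v}) D" "(\<Sum>(u, v)\<in>D. v - u) < \<delta>" for D
  proof -
    have "(\<Sum>(u, v)\<in>D. \<bar>?y v - ?y u\<bar>) = (\<Sum>(u, v)\<in>D. \<bar>c\<bar> * \<bar>x v - x u\<bar>)"
      using D(2) by (intro sum.cong) (auto simp: abs_mult[symmetric] algebra_simps)
    also have "\<dots> = \<bar>c\<bar> * (\<Sum>(u, v)\<in>D. \<bar>x v - x u\<bar>)"
      by (simp add: sum_distrib_left case_prod_unfold)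
    also have "\<dots> \<le> (\<bar>c\<bar> + 1) * (\<Sum>(u, v)\<in>D. \<bar>x v - x u\<bar>)"
      by (intro mult_right_mono sum_nonneg) auto
    also have "\<dots> < \<epsilon>"
      using \<delta>[OF D] by (simp add: field_simps)
    finally show ?thesis .
  qed
  with \<open>0 < \<delta>\<close> show "\<exists>\<delta>>0. \<forall>D. finite D \<and> (\<forall>(u, v)\<in>D. a \<le> u \<and> u \<le> v \<and> v \<le> b) \<and>
       disjoint_family_on (\<lambda>(u, v). {u<..<v}) D \<and> (\<Sum>(u, v)\<in>D. v - u) < \<delta> \<longrightarrow>
       (\<Sum>(u, v)\<in>D. \<bar>?y v - ?y u\<bar>) < \<epsilon>"
    by blast
qed

lemma nondecreasing_linear_functional_affine:
  assumes phi: "nondecreasing_linear_functional a b \<phi>" and x: "x \<in> AC a b"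
  shows "\<phi> (\<lambda>t\<in>{a..b}. c * x t + d) = c * \<phi> x + d * \<phi> (\<lambda>t\<in>{a..b}. 1)"
proof -
  have add: "\<phi> (\<lambda>t\<in>{a..b}. y t + z t) = \<phi> y + \<phi> z" if "y \<in> AC a b" "z \<in> AC a b" for y z
    using phi that by (simp add: nondecreasing_linear_functional_def)
  have scale: "\<phi> (\<lambda>t\<in>{a..b}. c * y t) = c * \<phi> y" if "y \<in> AC a b" for c y
    using phi that by (simp add: nondecreasing_linear_functional_def)
  have one: "(\<lambda>t\<in>{a..b}. 1) \<in> AC a b" using AC_affine[OF x, of 0 1] by simp
  have cx: "(\<lambda>t\<in>{a..b}. c * x t) \<in> AC a b" using AC_affine[OF x, of c 0] by simp
  have const: "(\<lambda>t\<in>{a..b}. d * (\<lambda>t\<in>{a..b}. 1) t) \<in> AC a b"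
    using AC_affine[OF one, of d 0] by simp
  have split: "(\<lambda>t\<in>{a..b}. c * x t + d) =
      (\<lambda>t\<in>{a..b}. (\<lambda>t\<in>{a..b}. c * x t) t + (\<lambda>t\<in>{a..b}. d * (\<lambda>t\<in>{a..b}. 1) t) t)"
    by (auto simp: fun_eq_iff restrict_def)
  show ?thesis
    by (simp only: split add[OF cx const] scale[OF x] scale[OF one])
qed

lemma has_real_derivative_affine_restrict:
  assumes "(w has_real_derivative D) (at t within S)" "t \<in> S"
  shows "((\<lambda>t\<in>S. c * w t + d) has_real_derivative c * D) (at t within S)"
proof (rule has_field_derivative_transform_within[OF _ zero_less_one])
  show "((\<lambda>t. c * w t + d) has_real_derivative c * D) (at t within S)"
    using assms(1) by (auto intro!: derivative_eq_intros)
qed (use assms(2) in auto)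

section \<open>Lower and upper solutions from the majorant equation\<close>

text \<open>Since \<open>w\<close> is nondecreasing, it dominates \<open>x\<close> at the delayed time \<open>\<tau> t\<close> by its own value at
  the current time \<open>t\<close>; this is where the delay is essential.\<close>

lemma delayed_growth_bound:
  fixes f :: "real \<Rightarrow> real \<Rightarrow> real \<Rightarrow> (real \<Rightarrow> real) \<Rightarrow> real" and h :: "real \<Rightarrow> real \<Rightarrow> real"
  assumes tau_into: "\<tau> \<in> {a..b} \<rightarrow> {a..b}"
    and delayed: "AE t in lebesgue_on {a..b}. \<tau> t \<le> t"
    and f_bound: "AE t in lebesgue_on {a..b}. \<forall>x y. \<forall>\<gamma>\<in>AC a b.
          \<bar>f t x y \<gamma>\<bar> \<le> p t * h \<bar>x\<bar> \<bar>y\<bar>"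
    and p_nonneg: "AE t in lebesgue_on {a..b}. 0 \<le> p t"
    and h_mono: "\<forall>u u' v v'. 0 \<le> u \<and> u \<le> u' \<and> 0 \<le> v \<and> v \<le> v' \<longrightarrow> h u v \<le> h u' v'"
    and w: "mono_on {a..b} w" and x: "x \<in> AC a b" and xw: "\<And>t. t \<in> {a..b} \<Longrightarrow> \<bar>x t\<bar> \<le> w t"
  shows "AE t in lebesgue_on {a..b}. \<bar>f t (x t) (x (\<tau> t)) x\<bar> \<le> p t * h (w t) (w t)"
  using delayed f_bound p_nonneg AE_space
proof eventually_elim
  case (elim t)
  then have t: "t \<in> {a..b}" "\<tau> t \<in> {a..b}" using tau_into by auto
  have "\<bar>x (\<tau> t)\<bar> \<le> w t"
    using xw[OF t(2)] mono_onD[OF w t(2,1) elim(1)] by linarith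
  then have "h \<bar>x t\<bar> \<bar>x (\<tau> t)\<bar> \<le> h (w t) (w t)"
    using h_mono xw[OF t(1)] by simp
  then have "p t * h \<bar>x t\<bar> \<bar>x (\<tau> t)\<bar> \<le> p t * h (w t) (w t)"
    using elim(3) by (rule mult_left_mono)
  moreover have "\<bar>f t (x t) (x (\<tau> t)) x\<bar> \<le> p t * h \<bar>x t\<bar> \<bar>x (\<tau> t)\<bar>"
    using elim(2) x by blast
  ultimately show ?case by linarith
qed

lemma ivp_solution_mono_on:
  assumes w: "ivp_solution a b p h m w"
    and p_nonneg: "AE t in lebesgue_on {a..b}. 0 \<le> p t"
    and h_nonneg: "\<forall>u\<ge>0. \<forall>v\<ge>0. 0 \<le> h u v"
  shows "mono_on {a..b} w"
proof (rule AC_mono_on)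
  show "w \<in> AC a b" using w by (simp add: ivp_solution_def)
  have w0: "\<forall>t\<in>{a..b}. 0 \<le> w t"
    and "AE t in lebesgue_on {a..b}. (w has_real_derivative p t * h (w t) (w t)) (at t within {a..b})"
    using w by (auto simp: ivp_solution_def)
  from this(2) show "AE t in lebesgue_on {a..b}. \<exists>d\<ge>0. (w has_real_derivative d) (at t within {a..b})"
    using p_nonneg AE_space
  proof eventually_elim
    case (elim t)
    then have "0 \<le> p t * h (w t) (w t)" using w0 h_nonneg by simp
    then show ?case using elim(1) by blast
  qed
qed

theorem theorem4p1:
  fixes a b :: real
    and f :: "real \<Rightarrow> real \<Rightarrow> real \<Rightarrow> (real \<Rightarrow> real) \<Rightarrow> real"
    and B :: "real \<Rightarrow> (real \<Rightarrow> real) \<Rightarrow> real"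
    and \<tau> p :: "real \<Rightarrow> real"
    and \<phi> :: "(real \<Rightarrow> real) \<Rightarrow> real"
    and h :: "real \<Rightarrow> real \<Rightarrow> real"
  assumes "a \<le> b"
    and tau_into: "\<tau> \<in> {a..b} \<rightarrow> {a..b}"
    and tau_measurable: "\<tau> \<in> borel_measurable (lebesgue_on {a..b})"
    and f_measurable: "\<forall>x\<in>AC a b.
          (\<lambda>t. f t (x t) (x (\<tau> t)) x) \<in> borel_measurable (lebesgue_on {a..b})"
    and delayed: "AE t in lebesgue_on {a..b}. \<tau> t \<le> t"
    and f_mono: "AE t in lebesgue_on {a..b}. \<forall>x. \<forall>\<gamma>\<in>AC a b. mono (\<lambda>y. f t x y \<gamma>)"
    and phi: "nondecreasing_linear_functional a b \<phi>"
    and B_eq: "\<forall>x\<in>AC a b. B (x a) x = x a - \<phi> x"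
    and f_bound: "AE t in lebesgue_on {a..b}. \<forall>x y. \<forall>\<gamma>\<in>AC a b.
          \<bar>f t x y \<gamma>\<bar> \<le> p t * h \<bar>x\<bar> \<bar>y\<bar>"
    and p_integrable: "integrable (lebesgue_on {a..b}) p"
    and p_nonneg: "AE t in lebesgue_on {a..b}. 0 \<le> p t"
    and h_nonneg: "\<forall>u\<ge>0. \<forall>v\<ge>0. 0 \<le> h u v"
    and h_mono: "\<forall>u u' v v'. 0 \<le> u \<and> u \<le> u' \<and> 0 \<le> v \<and> v \<le> v' \<longrightarrow> h u v \<le> h u' v'"
    and h_integral: "(\<integral>\<^sup>+u\<in>{0..}. 1 / ennreal (h u u) \<partial>lborel) = \<infinity>"
  shows "(\<forall>m n\<^sub>\<alpha> n\<^sub>\<beta> w. admissible_numbers a b p h \<phi> m n\<^sub>\<alpha> n\<^sub>\<beta> w \<longrightarrow>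
            lower_solution a b f \<tau> B (\<lambda>t\<in>{a..b}. - w t + n\<^sub>\<alpha>) \<and>
            upper_solution a b f \<tau> B (\<lambda>t\<in>{a..b}. w t - n\<^sub>\<beta>) \<and>
            (\<forall>t\<in>{a..b}. (\<lambda>t\<in>{a..b}. - w t + n\<^sub>\<alpha>) t \<le> (\<lambda>t\<in>{a..b}. w t - n\<^sub>\<beta>) t)) \<and>
         ((\<exists>m n\<^sub>\<alpha> n\<^sub>\<beta> w. admissible_numbers a b p h \<phi> m n\<^sub>\<alpha> n\<^sub>\<beta> w) \<longrightarrow>
            (\<exists>\<alpha>. lower_solution a b f \<tau> B \<alpha>) \<and> (\<exists>\<beta>. upper_solution a b f \<tau> B \<beta>))"
proof -
  have main: "lower_solution a b f \<tau> B (\<lambda>t\<in>{a..b}. - w t + n\<^sub>\<alpha>) \<and>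
      upper_solution a b f \<tau> B (\<lambda>t\<in>{a..b}. w t - n\<^sub>\<beta>) \<and>
      (\<forall>t\<in>{a..b}. (\<lambda>t\<in>{a..b}. - w t + n\<^sub>\<alpha>) t \<le> (\<lambda>t\<in>{a..b}. w t - n\<^sub>\<beta>) t)"
    if adm: "admissible_numbers a b p h \<phi> m n\<^sub>\<alpha> n\<^sub>\<beta> w" for m n\<^sub>\<alpha> n\<^sub>\<beta> w
  proof -
    have n: "0 \<le> n\<^sub>\<alpha>" "0 \<le> n\<^sub>\<beta>" "n\<^sub>\<alpha> \<le> m" "n\<^sub>\<beta> \<le> m"
      and ivp: "ivp_solution a b p h m w"
      and n\<alpha>: "n\<^sub>\<alpha> * (1 - \<phi> (\<lambda>t\<in>{a..b}. 1)) \<le> m - \<phi> w"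
      and n\<beta>: "n\<^sub>\<beta> * (1 - \<phi> (\<lambda>t\<in>{a..b}. 1)) \<le> m - \<phi> w"
      using adm by (auto simp: admissible_numbers_def)
    have w: "w \<in> AC a b" and wa: "w a = m"
      and w': "AE t in lebesgue_on {a..b}. (w has_real_derivative p t * h (w t) (w t)) (at t within {a..b})"
      using ivp by (auto simp: ivp_solution_def)
    have mono: "mono_on {a..b} w" using ivp p_nonneg h_nonneg by (rule ivp_solution_mono_on)
    have m_le: "m \<le> w t" if "t \<in> {a..b}" for t
      using mono_onD[OF mono, of a t] that wa by auto
    have a: "a \<in> {a..b}" using \<open>a \<le> b\<close> by simp
    define \<alpha> where "\<alpha> = (\<lambda>t\<in>{a..b}. - 1 * w t + n\<^sub>\<alpha>)"
    define \<beta> where "\<beta> = (\<lambda>t\<in>{a..b}. 1 * w t + - n\<^sub>\<beta>)"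
    have \<alpha>a: "\<alpha> a = n\<^sub>\<alpha> - m" and \<beta>a: "\<beta> a = m - n\<^sub>\<beta>"
      using a wa by (simp_all add: \<alpha>_def \<beta>_def)
    have AC: "\<alpha> \<in> AC a b" "\<beta> \<in> AC a b" unfolding \<alpha>_def \<beta>_def using w by (rule AC_affine)+
    have abs: "\<bar>\<alpha> t\<bar> \<le> w t" "\<bar>\<beta> t\<bar> \<le> w t" if "t \<in> {a..b}" for t
      using m_le[OF that] n that by (auto simp: \<alpha>_def \<beta>_def)
    have bound: "AE t in lebesgue_on {a..b}. \<bar>f t (x t) (x (\<tau> t)) x\<bar> \<le> p t * h (w t) (w t)"
      if "x \<in> AC a b" "\<And>t. t \<in> {a..b} \<Longrightarrow> \<bar>x t\<bar> \<le> w t" for x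
      using tau_into delayed f_bound p_nonneg h_mono mono that by (rule delayed_growth_bound)
    have f\<alpha>: "AE t in lebesgue_on {a..b}. \<bar>f t (\<alpha> t) (\<alpha> (\<tau> t)) \<alpha>\<bar> \<le> p t * h (w t) (w t)"
      and f\<beta>: "AE t in lebesgue_on {a..b}. \<bar>f t (\<beta> t) (\<beta> (\<tau> t)) \<beta>\<bar> \<le> p t * h (w t) (w t)"
      by (rule bound[OF AC(1)], erule abs(1)) (rule bound[OF AC(2)], erule abs(2))
    have lower: "lower_solution a b f \<tau> B \<alpha>"
      unfolding lower_solution_def
    proof (intro conjI)
      show "\<alpha> \<in> AC a b" by (fact AC)
      show "(\<lambda>t. f t (\<alpha> t) (\<alpha> (\<tau> t)) \<alpha>) \<in> borel_measurable (lebesgue_on {a..b})"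
        using f_measurable AC by blast
      show "AE t in lebesgue_on {a..b}. \<exists>d. (\<alpha> has_real_derivative d) (at t within {a..b}) \<and>
          d \<le> f t (\<alpha> t) (\<alpha> (\<tau> t)) \<alpha>"
        using w' f\<alpha> AE_space
      proof eventually_elim
        case (elim t)
        then have "(\<alpha> has_real_derivative - 1 * (p t * h (w t) (w t))) (at t within {a..b})"
          unfolding \<alpha>_def by (intro has_real_derivative_affine_restrict) auto
        moreover have "- 1 * (p t * h (w t) (w t)) \<le> f t (\<alpha> t) (\<alpha> (\<tau> t)) \<alpha>"
          using elim(2) by linarith
        ultimately show ?case by blast
      qed
      have "B (\<alpha> a) \<alpha> = n\<^sub>\<alpha> * (1 - \<phi> (\<lambda>t\<in>{a..b}. 1)) - (m - \<phi> w)"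
      proof -
        have "B (\<alpha> a) \<alpha> = \<alpha> a - \<phi> \<alpha>" using B_eq AC(1) by blast
        also have "\<phi> \<alpha> = - 1 * \<phi> w + n\<^sub>\<alpha> * \<phi> (\<lambda>t\<in>{a..b}. 1)"
          unfolding \<alpha>_def using phi w by (rule nondecreasing_linear_functional_affine)
        finally show ?thesis
          unfolding \<alpha>a by (simp add: algebra_simps)
      qed
      then show "B (\<alpha> a) \<alpha> \<le> 0" using n\<alpha> by simp
    qed
    have upper: "upper_solution a b f \<tau> B \<beta>"
      unfolding upper_solution_def
    proof (intro conjI)
      show "\<beta> \<in> AC a b" by (fact AC)
      show "(\<lambda>t. f t (\<beta> t) (\<beta> (\<tau> t)) \<beta>) \<in> borel_measurable (lebesgue_on {a..b})"
        using f_measurable AC by blast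
      show "AE t in lebesgue_on {a..b}. \<exists>d. (\<beta> has_real_derivative d) (at t within {a..b}) \<and>
          d \<ge> f t (\<beta> t) (\<beta> (\<tau> t)) \<beta>"
        using w' f\<beta> AE_space
      proof eventually_elim
        case (elim t)
        then have "(\<beta> has_real_derivative 1 * (p t * h (w t) (w t))) (at t within {a..b})"
          unfolding \<beta>_def by (intro has_real_derivative_affine_restrict) auto
        moreover have "f t (\<beta> t) (\<beta> (\<tau> t)) \<beta> \<le> 1 * (p t * h (w t) (w t))"
          using elim(2) by linarith
        ultimately show ?case by blast
      qed
      have "B (\<beta> a) \<beta> = (m - \<phi> w) - n\<^sub>\<beta> * (1 - \<phi> (\<lambda>t\<in>{a..b}. 1))"
      proof -
        have "B (\<beta> a) \<beta> = \<beta> a - \<phi> \<beta>" using B_eq AC(2) by blast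
        also have "\<phi> \<beta> = 1 * \<phi> w + - n\<^sub>\<beta> * \<phi> (\<lambda>t\<in>{a..b}. 1)"
          unfolding \<beta>_def using phi w by (rule nondecreasing_linear_functional_affine)
        finally show ?thesis
          unfolding \<beta>a by (simp add: algebra_simps)
      qed
      then show "B (\<beta> a) \<beta> \<ge> 0" using n\<beta> by simp
    qed
    have "\<alpha> t \<le> \<beta> t" if "t \<in> {a..b}" for t
      using m_le[OF that] n that by (simp add: \<alpha>_def \<beta>_def)
    with lower upper show ?thesis by (simp add: \<alpha>_def \<beta>_def)
  qed
  then show ?thesis by blast
qed

end
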